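(* For every integer $n\ge1$, the optimal worst-case success probability of deterministic policies in the adversarial-order full-history model with $m=2$ signals (defined in the context) is $$\mathrm{OPT}^{\mathrm{det,full}}_n(2)=\max\Bigl\{z\in[0,1]:\ \sum_{t=1}^{\ell}\lceil z t^2\rceil\le\ell^2\ \text{ for all }\ell\in[n]\Bigr\}.$$
   Context: Notation: $[n]=\{1,\dots,n\}$. Adversarial-order full-history model with $m$ signals: an adversary fixes an instance, i.e. a value vector $v\in\mathbb{N}_0^n$ with a unique maximum entry, located at a time $i^\star\in[n]$. Items arrive one by one at times $1,\dots,n$ in this order. Signal times $S_1,\dots,S_m$ are drawn independently and uniformly from $[i^\star]$. At each time $t$ the policy observes $v_t$ and the number of signals occurring at time $t$ (signals are unlabeled), and then irrevocably decides whether to stop at time $t$. It knows $n$ and $m$, but not the instance; it succeeds if it stops exactly at time $i^\star$. A deterministic policy uses no internal randomness: its decision at time $t$ is a function of the observations up to time $t$. The worst-case success probability of a policy is the infimum over all instances of length $n$ of its success probability (over the signals). $\mathrm{OPT}^{\mathrm{det,full}}_n(m)$ is the supremum of the worst-case success probability over all deterministic policies. *)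

theory Defs
  imports "HOL-Probability.Probability"
begin

text \<open>Times, and hence the indices of a value vector, start at 1; a vector in \<open>\<nat>\<^sub>0\<^sup>n\<close> is an
  extensional function on \<open>{1..n}\<close>.\<close>

definition unique_peak :: "nat \<Rightarrow> (nat \<Rightarrow> nat) \<Rightarrow> nat \<Rightarrow> bool" where
  "unique_peak n v i \<longleftrightarrow> i \<in> {1..n} \<and> (\<forall>j\<in>{1..n} - {i}. v j < v i)"

definition instances :: "nat \<Rightarrow> (nat \<Rightarrow> nat) set" where
  "instances n = {v \<in> {1..n} \<rightarrow>\<^sub>E UNIV. \<exists>i. unique_peak n v i}"

definition peak_time :: "nat \<Rightarrow> (nat \<Rightarrow> nat) \<Rightarrow> nat" where
  "peak_time n v = (THE i. unique_peak n v i)"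

text \<open>The joint law of the signal times \<open>s 1, \<dots>, s m\<close> (\<open>s\<close> is 0 outside \<open>{1..m}\<close>).\<close>

definition signal_pmf :: "nat \<Rightarrow> nat \<Rightarrow> (nat \<Rightarrow> nat) pmf" where
  "signal_pmf m i = Pi_pmf {1..m} 0 (\<lambda>_. pmf_of_set {1..i})"

definition signal_count :: "nat \<Rightarrow> (nat \<Rightarrow> nat) \<Rightarrow> nat \<Rightarrow> nat" where
  "signal_count m s t = card {j \<in> {1..m}. s j = t}"

definition history :: "nat \<Rightarrow> (nat \<Rightarrow> nat) \<Rightarrow> (nat \<Rightarrow> nat) \<Rightarrow> nat \<Rightarrow> (nat \<times> nat) list" where
  "history m v s t = map (\<lambda>k. (v k, signal_count m s k)) [1..<Suc t]"

text \<open>A deterministic policy maps the observations made so far, in chronological order, to the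
  decision whether to stop now; only the first such decision takes effect.\<close>

type_synonym policy = "(nat \<times> nat) list \<Rightarrow> bool"

definition stops_at :: "policy \<Rightarrow> nat \<Rightarrow> (nat \<Rightarrow> nat) \<Rightarrow> (nat \<Rightarrow> nat) \<Rightarrow> nat \<Rightarrow> bool" where
  "stops_at \<pi> m v s t \<longleftrightarrow>
     \<pi> (history m v s t) \<and> (\<forall>k\<in>{1..<t}. \<not> \<pi> (history m v s k))"

definition success_prob :: "policy \<Rightarrow> nat \<Rightarrow> nat \<Rightarrow> (nat \<Rightarrow> nat) \<Rightarrow> real" where
  "success_prob \<pi> n m v =
     measure_pmf.prob (signal_pmf m (peak_time n v)) {s. stops_at \<pi> m v s (peak_time n v)}"

definition worst_case :: "policy \<Rightarrow> nat \<Rightarrow> nat \<Rightarrow> real" where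
  "worst_case \<pi> n m = (INF v\<in>instances n. success_prob \<pi> n m v)"

text \<open>The policy is chosen after \<open>n\<close> and \<open>m\<close>, so it may depend on them.\<close>

definition OPT_det_full :: "nat \<Rightarrow> nat \<Rightarrow> real" where
  "OPT_det_full n m = (SUP \<pi>. worst_case \<pi> n m)"

text \<open>The constant \<open>Max\<close> is only meaningful on finite sets.\<close>

definition is_maximum :: "real set \<Rightarrow> real \<Rightarrow> bool" where
  "is_maximum A x \<longleftrightarrow> x \<in> A \<and> (\<forall>y\<in>A. y \<le> x)"

end

theory Submission
  imports Defs
begin

text \<open>If the peak is at time \<open>t\<close>, the two signals form a uniformly random cell of the square
  \<open>[t]\<^sup>2\<close>. Facing increasing values, a policy cannot tell the instances with peaks at \<open>t < l\<close> apart
  up to time \<open>t\<close>, so its success events for \<open>t \<le> l\<close> are disjoint subsets of \<open>[l]\<^sup>2\<close>;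
  if it always succeeds with probability at least \<open>z\<close>, the event for \<open>t\<close> has at least
  \<open>\<lceil>z t\<^sup>2\<rceil>\<close> cells. Conversely it suffices to choose disjoint sets
  \<open>A t \<subseteq> [t]\<^sup>2\<close> of this size and to stop at \<open>t\<close> iff the signals seen form a cell of \<open>A t\<close>, ignoring
  the values. As signals are unlabeled, \<open>A t\<close> has to be symmetric. The greedy choice still
  works: the fresh diagonal cell \<open>(t, t)\<close> is always available to correct the parity.\<close>

section \<open>Signals as a uniform point of a finite cube; instances and their peaks\<close>

definition signal_space :: "nat \<Rightarrow> nat \<Rightarrow> (nat \<Rightarrow> nat) set" where
  "signal_space m i = PiE_dflt {1..m} 0 (\<lambda>_. {1..i})"

lemma finite_signal_space [simp]: "finite (signal_space m i)"
  unfolding signal_space_def by (rule finite_PiE_dflt) auto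

lemma card_signal_space: "card (signal_space m i) = i ^ m"
  unfolding signal_space_def by (subst card_PiE_dflt) auto

lemma signal_space_mono: "i \<le> j \<Longrightarrow> signal_space m i \<subseteq> signal_space m j"
  unfolding signal_space_def PiE_dflt_def by fastforce

lemma prob_signal_pmf:
  assumes "i \<ge> 1"
  shows "measure_pmf.prob (signal_pmf m i) S = card (signal_space m i \<inter> S) / real i ^ m"
proof -
  have "signal_pmf m i = pmf_of_set (signal_space m i)"
    unfolding signal_pmf_def signal_space_def using assms by (intro Pi_pmf_of_set) auto
  moreover have "signal_space m i \<noteq> {}"
    using card_signal_space[of m i] assms by auto
  ultimately show ?thesis
    by (simp add: measure_pmf_of_set card_signal_space)
qed

lemma peak_time_eqI:
  assumes "unique_peak n v i"
  shows "peak_time n v = i"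
  unfolding peak_time_def
proof (rule the_equality)
  fix j assume j: "unique_peak n v j"
  show "j = i"
  proof (rule ccontr)
    assume "j \<noteq> i"
    then have "v i < v j" "v j < v i" using assms j by (auto simp: unique_peak_def)
    then show False by simp
  qed
qed (rule assms)

lemma peak_time_in:
  assumes "v \<in> instances n"
  shows "peak_time n v \<in> {1..n}"
proof -
  obtain i where "unique_peak n v i" using assms by (auto simp: instances_def)
  with peak_time_eqI[OF this] show ?thesis by (auto simp: unique_peak_def)
qed

lemma success_prob_eq:
  assumes "v \<in> instances n" "peak_time n v = i"
  shows "success_prob \<pi> n m v =
    card (signal_space m i \<inter> {s. stops_at \<pi> m v s i}) / real i ^ m"
  using prob_signal_pmf[of i m] peak_time_in[OF assms(1)] assms(2)
  by (auto simp: success_prob_def)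

lemma worst_case_le: "v \<in> instances n \<Longrightarrow> worst_case \<pi> n m \<le> success_prob \<pi> n m v"
  unfolding worst_case_def
  by (intro cINF_lower bdd_belowI[of _ 0]) (auto simp: success_prob_def)

section \<open>Upper bound: indistinguishable instances and counting\<close>

definition ramp :: "nat \<Rightarrow> nat \<Rightarrow> nat \<Rightarrow> nat" where
  "ramp n l = restrict (\<lambda>k. if k \<le> l then k else 0) {1..n}"

lemma unique_peak_ramp: "l \<in> {1..n} \<Longrightarrow> unique_peak n (ramp n l) l"
  by (auto simp: unique_peak_def ramp_def)

lemma ramp_in_instances: "l \<in> {1..n} \<Longrightarrow> ramp n l \<in> instances n"
  using unique_peak_ramp by (auto simp: instances_def ramp_def)

lemma instances_nonempty: "n \<ge> 1 \<Longrightarrow> instances n \<noteq> {}"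
  using ramp_in_instances[of 1 n] by auto

text \<open>Every success probability is a fraction \<open>k / i ^ m\<close> with
  \<open>k <= n ^ m\<close> and \<open>i <= n\<close>. So only finitely many values occur, despite
  infinitely many instances and policies, and both the infimum in \<open>worst_case\<close> and the
  supremum over policies are attained.\<close>

lemma OPT_det_full_attained:
  assumes "n \<ge> 1"
  shows "\<exists>\<pi>. OPT_det_full n m = worst_case \<pi> n m"
    and "worst_case \<pi> n m \<le> OPT_det_full n m"
proof -
  define F where "F = (\<lambda>(k, i). real k / real i ^ m) ` ({..n ^ m} \<times> {1..n})"
  have fin: "finite F" by (simp add: F_def)
  have sub: "success_prob \<pi> n m ` instances n \<subseteq> F" for \<pi>
  proof
    fix x assume "x \<in> success_prob \<pi> n m ` instances n"
    then obtain v where v: "v \<in> instances n" "x = success_prob \<pi> n m v" by auto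
    define i where "i = peak_time n v"
    define k where "k = card (signal_space m i \<inter> {s. stops_at \<pi> m v s i})"
    have i: "i \<in> {1..n}" using peak_time_in v(1) by (simp add: i_def)
    have "k \<le> i ^ m"
      unfolding k_def card_signal_space[symmetric] by (rule card_mono) auto
    also have "\<dots> \<le> n ^ m" using i by (intro power_mono) auto
    finally have "(k, i) \<in> {..n ^ m} \<times> {1..n}" using i by simp
    moreover have "x = real k / real i ^ m"
      using v success_prob_eq[OF v(1) i_def[symmetric]] by (simp add: k_def)
    ultimately show "x \<in> F" unfolding F_def by force
  qed
  have "worst_case \<pi> n m \<in> F" for \<pi>
  proof -
    have "Inf (success_prob \<pi> n m ` instances n) \<in> success_prob \<pi> n m ` instances n"
      using finite_subset[OF sub fin] instances_nonempty[OF assms]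
      by (subst cInf_eq_Min) (auto intro!: Min_in)
    then show ?thesis using sub[of \<pi>] unfolding worst_case_def by blast
  qed
  then have fin': "finite (range (\<lambda>\<pi>. worst_case \<pi> n m))"
    by (intro finite_subset[OF _ fin]) auto
  then have "OPT_det_full n m = Max (range (\<lambda>\<pi>. worst_case \<pi> n m))"
    unfolding OPT_det_full_def by (intro cSup_eq_Max) auto
  with Max_in[OF fin'] Max_ge[OF fin']
  show "\<exists>\<pi>. OPT_det_full n m = worst_case \<pi> n m"
    and "worst_case \<pi> n m \<le> OPT_det_full n m" by auto
qed

text \<open>Both ramps show the values 1, ..., \<open>k\<close> up to time \<open>k\<close>, so no
  observation up to time \<open>t\<close> reveals whether the peak is at \<open>t\<close> or
  later.\<close>

lemma history_ramp_eq:
  "k \<le> t \<Longrightarrow> t \<le> l \<Longrightarrow> l \<le> n \<Longrightarrow> history m (ramp n t) s k = history m (ramp n l) s k"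
  by (auto simp: history_def ramp_def)

lemma stops_at_ramp_eq:
  "t \<le> l \<Longrightarrow> l \<le> n \<Longrightarrow> stops_at \<pi> m (ramp n t) s t \<longleftrightarrow> stops_at \<pi> m (ramp n l) s t"
  unfolding stops_at_def using history_ramp_eq[of _ t l n m s]
  by (auto simp: less_imp_le_nat)

lemma stops_at_unique:
  assumes "stops_at \<pi> m v s t" "stops_at \<pi> m v s u" "t \<ge> 1" "u \<ge> 1"
  shows "t = u"
  using assms by (cases t u rule: linorder_cases) (auto simp: stops_at_def)

lemma sum_ceiling_worst_case_le:
  assumes l: "l \<in> {1..n}"
  shows "(\<Sum>t = 1..l. \<lceil>worst_case \<pi> n m * real t ^ m\<rceil>) \<le> int l ^ m"
proof -
  define B where "B t = signal_space m t \<inter> {s. stops_at \<pi> m (ramp n t) s t}" for t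
  have "\<lceil>worst_case \<pi> n m * real t ^ m\<rceil> \<le> int (card (B t))" if t: "t \<in> {1..l}" for t
  proof -
    have t': "t \<in> {1..n}" using t l by auto
    have "worst_case \<pi> n m \<le> card (B t) / real t ^ m"
      unfolding B_def
      using worst_case_le[OF ramp_in_instances[OF t']]
        success_prob_eq[OF ramp_in_instances[OF t'] peak_time_eqI[OF unique_peak_ramp[OF t']]]
      by metis
    then have "worst_case \<pi> n m * real t ^ m \<le> card (B t)"
      using t by (simp add: pos_le_divide_eq)
    then show ?thesis by (simp add: ceiling_le_iff)
  qed
  then have "(\<Sum>t = 1..l. \<lceil>worst_case \<pi> n m * real t ^ m\<rceil>) \<le> (\<Sum>t = 1..l. int (card (B t)))"
    by (rule sum_mono)
  also have "\<dots> = int (card (\<Union>t\<in>{1..l}. B t))"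
  proof (subst card_UN_disjoint)
    show "\<forall>t\<in>{1..l}. \<forall>u\<in>{1..l}. t \<noteq> u \<longrightarrow> B t \<inter> B u = {}"
    proof (intro ballI impI equals0I)
      fix t u s assume tu: "t \<in> {1..l}" "u \<in> {1..l}" "t \<noteq> u" and s: "s \<in> B t \<inter> B u"
      \<comment> \<open>\<open>B t\<close> and \<open>B u\<close> refer to different instances; both
        events are moved to the common instance \<open>ramp n l\<close>, on which a policy stops
        only once.\<close>
      have "stops_at \<pi> m (ramp n l) s t" "stops_at \<pi> m (ramp n l) s u"
        using s tu l stops_at_ramp_eq[of _ l n \<pi> m s] by (auto simp: B_def)
      then show False using stops_at_unique tu by auto
    qed
  qed (auto simp: B_def)
  also have "\<dots> \<le> int (card (signal_space m l))"
    using signal_space_mono[of _ l m] by (intro of_nat_mono card_mono) (fastforce simp: B_def)+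
  finally show ?thesis by (simp add: card_signal_space)
qed

section \<open>Lower bound: disjoint symmetric sets of prescribed sizes\<close>

lemma symmetric_subset_of_card:
  assumes "finite R" "sym R" "(d, d) \<in> R" "c \<le> card R"
  shows "\<exists>B \<subseteq> R. sym B \<and> card B = c"
  using assms
proof (induction "card R" arbitrary: R rule: less_induct)
  case less
  note fin = less.prems(1) and symR = less.prems(2) and d = less.prems(3)
  show ?case
  \<comment> \<open>On the diagonal every subset is symmetric. Otherwise removing a mirrored pair of
    off-diagonal cells keeps \<open>(d, d)\<close> and lowers the size by 2. Induction then covers
    every \<open>c\<close> except \<open>card R\<close> and \<open>card R - 1\<close>; the latter is
    reached by removing \<open>(d, d)\<close> alone.\<close>
  proof (cases "R \<subseteq> Id")
    case True
    obtain B where "B \<subseteq> R" "card B = c"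
      using obtain_subset_with_card_n[OF less.prems(4)] by metis
    moreover have "sym B" using \<open>B \<subseteq> R\<close> True by (auto simp: sym_def)
    ultimately show ?thesis by blast
  next
    case False
    then obtain a b where ab: "(a, b) \<in> R" "a \<noteq> b" by auto
    then have ba: "(b, a) \<in> R" using symR by (auto dest: symD)
    consider "c = card R" | "c = card R - 1" | "c \<le> card R - 2"
      using less.prems(4) by linarith
    then show ?thesis
    proof cases
      case 1
      then show ?thesis using symR by blast
    next
      case 2
      have "sym (R - {(d, d)})" using symR by (auto simp: sym_def)
      then show ?thesis using 2 d by (intro exI[of _ "R - {(d, d)}"]) auto
    next
      case 3
      let ?R = "R - {(a, b), (b, a)}"
      have card: "card ?R = card R - 2"
        using ab ba fin by (subst card_Diff_subset) auto
      have "sym ?R" using symR by (auto simp: sym_def)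
      moreover have "card ?R < card R"
        using ab fin by (intro psubset_card_mono) auto
      ultimately obtain B where "B \<subseteq> ?R" "sym B" "card B = c"
        using less.hyps[of ?R] fin d ab 3 card by auto
      then show ?thesis by blast
    qed
  qed
qed

text \<open>Each new set is carved from the cells that the earlier sets leave free. How these were
  chosen does not matter: the free region is symmetric because their union is, and its size depends
  only on their sizes.\<close>

lemma disjoint_symmetric_sets:
  fixes c :: "nat \<Rightarrow> nat"
  assumes "\<And>l. l \<in> {1..n} \<Longrightarrow> (\<Sum>t = 1..l. c t) \<le> l\<^sup>2"
  shows "\<exists>A. (\<forall>t\<in>{1..n}. A t \<subseteq> {1..t} \<times> {1..t} \<and> sym (A t) \<and> card (A t) = c t) \<and>
    disjoint_family_on A {1..n}"
  using assms
proof (induction n)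
  case 0
  then show ?case by (auto simp: disjoint_family_on_def)
next
  case (Suc n)
  have "(\<Sum>t = 1..l. c t) \<le> l\<^sup>2" if "l \<in> {1..n}" for l
    using that by (intro Suc.prems) auto
  from Suc.IH[OF this] obtain A where A: "\<And>t. t \<in> {1..n} \<Longrightarrow> A t \<subseteq> {1..t} \<times> {1..t}"
      "\<And>t. t \<in> {1..n} \<Longrightarrow> sym (A t)" "\<And>t. t \<in> {1..n} \<Longrightarrow> card (A t) = c t"
      "disjoint_family_on A {1..n}"
    by blast
  define U where "U = (\<Union>t\<in>{1..n}. A t)"
  define R where "R = {1..Suc n} \<times> {1..Suc n} - U"
  have U: "U \<subseteq> {1..n} \<times> {1..n}" using A(1) by (fastforce simp: U_def)
  have finA: "finite (A t)" if "t \<in> {1..n}" for t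
    using A(1)[OF that] by (rule finite_subset) auto
  have "sym U" unfolding U_def using A(2) by (intro sym_UNION) auto
  then have symR: "sym R" by (auto simp: R_def sym_def)
  have "card U = (\<Sum>t = 1..n. c t)"
    unfolding U_def using finA A(3,4)
    by (subst card_UN_disjoint) (auto simp: disjoint_family_on_def)
  moreover have "card R = (Suc n)\<^sup>2 - card U"
  proof -
    have "U \<subseteq> {1..Suc n} \<times> {1..Suc n}" using U by fastforce
    then show ?thesis
      unfolding R_def using finite_subset[OF U]
      by (subst card_Diff_subset) (auto simp: power2_eq_square card_cartesian_product)
  qed
  \<comment> \<open>The hypothesis at \<open>l = Suc n\<close> says exactly that enough cells are
    left.\<close>
  ultimately have "c (Suc n) \<le> card R"
    using Suc.prems[of "Suc n"] by simp
  \<comment> \<open>Earlier sets lie in the square of side \<open>n\<close>, so the new corner is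
    free and serves as the diagonal cell \<open>(d, d)\<close>.\<close>
  moreover have "(Suc n, Suc n) \<in> R" using U by (auto simp: R_def)
  moreover have "finite R" by (simp add: R_def)
  ultimately obtain B where B: "B \<subseteq> R" "sym B" "card B = c (Suc n)"
    using symmetric_subset_of_card[OF _ symR] by blast
  have disj: "A t \<inter> B = {}" if "t \<in> {1..n}" for t
    using that B(1) by (auto simp: R_def U_def)
  let ?A = "A(Suc n := B)"
  have "\<forall>t\<in>{1..Suc n}. ?A t \<subseteq> {1..t} \<times> {1..t} \<and> sym (?A t) \<and> card (?A t) = c t"
  proof
    fix t assume "t \<in> {1..Suc n}"
    then consider "t \<in> {1..n}" | "t = Suc n" by fastforce
    then show "?A t \<subseteq> {1..t} \<times> {1..t} \<and> sym (?A t) \<and> card (?A t) = c t"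
    proof cases
      case 1 then show ?thesis using A(1-3)[of t] by auto
    next
      case 2 then show ?thesis using B by (auto simp: R_def)
    qed
  qed
  moreover have "disjoint_family_on ?A {1..Suc n}"
    unfolding disjoint_family_on_def
  proof (intro ballI impI)
    fix t u assume tu: "t \<in> {1..Suc n}" "u \<in> {1..Suc n}" "t \<noteq> u"
    then consider "t \<in> {1..n}" "u \<in> {1..n}" | "t = Suc n" "u \<in> {1..n}" | "t \<in> {1..n}" "u = Suc n"
      by fastforce
    then show "?A t \<inter> ?A u = {}"
      using disj A(4) tu(3) by cases (auto simp: disjoint_family_on_def)
  qed
  ultimately show ?case by blast
qed

section \<open>The policy built from these sets\<close>

lemma signal_count_2: "signal_count 2 s t = of_bool (s 1 = t) + of_bool (s 2 = t)"
proof -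
  have "{j \<in> {1..2::nat}. s j = t} = (if s 1 = t then {1} else {}) \<union> (if s 2 = t then {2} else {})"
    by (auto simp: le_Suc_eq numeral_2_eq_2)
  then show ?thesis by (auto simp: signal_count_def)
qed

text \<open>Unlabeled signals only allow a test whether the observed counts are those of some cell
  in the set for the current time, which is the length of the history. Taking \<open>map snd\<close>
  discards the values.\<close>

definition pair_policy :: "(nat \<Rightarrow> (nat \<times> nat) set) \<Rightarrow> policy" where
  "pair_policy A h \<longleftrightarrow> (\<exists>(a, b) \<in> A (length h).
     map snd h = map (\<lambda>k. of_bool (a = k) + of_bool (b = k)) [1..<Suc (length h)])"

text \<open>Counts determine the pair up to order, and symmetry of \<open>A t\<close> makes the
  order immaterial. If a signal is still to come, the counts sum to less than 2 and match no cell of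
  \<open>A t\<close>.\<close>

lemma pair_policy_history:
  assumes sub: "A t \<subseteq> {1..t} \<times> {1..t}" and "sym (A t)"
  shows "pair_policy A (history 2 v s t) \<longleftrightarrow> (s 1, s 2) \<in> A t"
proof
  assume "(s 1, s 2) \<in> A t"
  then show "pair_policy A (history 2 v s t)"
    by (auto simp: pair_policy_def history_def signal_count_2 simp del: upt_Suc
        intro!: bexI[of _ "(s 1, s 2)"])
next
  assume "pair_policy A (history 2 v s t)"
  then obtain a b where ab: "(a, b) \<in> A t" and
    eq: "\<And>k. k \<in> {1..t} \<Longrightarrow>
      of_bool (s 1 = k) + of_bool (s 2 = k) = (of_bool (a = k) + of_bool (b = k) :: nat)"
    by (auto simp: pair_policy_def history_def signal_count_2 simp del: upt_Suc)
  have "a \<in> {1..t}" "b \<in> {1..t}" using ab sub by auto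
  \<comment> \<open>The counts at \<open>a\<close> and \<open>b\<close> suffice: both are positive,
    and equal to 2 if \<open>a = b\<close>, so the two signals fill exactly these places.\<close>
  from eq[OF this(1)] eq[OF this(2)]
  have "(s 1, s 2) = (a, b) \<or> (s 1, s 2) = (b, a)"
    by (cases "s 1 = a"; cases "s 2 = b"; cases "a = b"; cases "s 1 = b"; cases "s 2 = a") auto
  then show "(s 1, s 2) \<in> A t" using ab \<open>sym (A t)\<close> by (auto dest: symD)
qed

lemma card_signal_space_pairs:
  assumes "A \<subseteq> {1..t} \<times> {1..t}"
  shows "card (signal_space 2 t \<inter> {s. (s 1, s 2) \<in> A}) = card A"
proof (rule bij_betw_same_card)
  \<comment> \<open>The inverse map must be 0 off \<open>{1, 2}\<close>, the default value in
    \<open>signal_space\<close>.\<close>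
  let ?f = "\<lambda>(a, b) j. if j = 1 then a else if j = 2 then b else 0"
  show "bij_betw (\<lambda>s. (s 1, s 2)) (signal_space 2 t \<inter> {s. (s 1, s 2) \<in> A}) A"
  proof (rule bij_betw_byWitness[where f' = ?f])
    show "\<forall>s\<in>signal_space 2 t \<inter> {s. (s 1, s 2) \<in> A}. ?f (s 1, s 2) = s"
      by (force simp: signal_space_def PiE_dflt_def fun_eq_iff)
    show "?f ` A \<subseteq> signal_space 2 t \<inter> {s. (s 1, s 2) \<in> A}"
      using assms by (fastforce simp: signal_space_def PiE_dflt_def)
  qed auto
qed

lemma success_prob_pair_policy:
  assumes v: "v \<in> instances n"
    and A: "\<And>t. t \<in> {1..n} \<Longrightarrow> A t \<subseteq> {1..t} \<times> {1..t}" "\<And>t. t \<in> {1..n} \<Longrightarrow> sym (A t)"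
    and disj: "disjoint_family_on A {1..n}"
  shows "success_prob (pair_policy A) n 2 v = card (A (peak_time n v)) / (real (peak_time n v))\<^sup>2"
proof -
  define i where "i = peak_time n v"
  have i: "i \<in> {1..n}" using peak_time_in v by (simp add: i_def)
  have "stops_at (pair_policy A) 2 v s i \<longleftrightarrow> (s 1, s 2) \<in> A i" for s
  proof -
    have "pair_policy A (history 2 v s t) \<longleftrightarrow> (s 1, s 2) \<in> A t" if "t \<in> {1..i}" for t
      using that i A by (intro pair_policy_history) auto
    \<comment> \<open>Disjointness rules out a stop before \<open>i\<close> when the signals form a
      cell of \<open>A i\<close>.\<close>
    moreover have "A t \<inter> A i = {}" if "t \<in> {1..<i}" for t
      using disj that i by (auto simp: disjoint_family_on_def)
    ultimately show ?thesis using i by (fastforce simp: stops_at_def)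
  qed
  then show ?thesis
    using success_prob_eq[OF v i_def[symmetric]] card_signal_space_pairs[OF A(1)[OF i]]
    by (simp add: i_def)
qed

lemma exists_policy_worst_case_ge:
  assumes "n \<ge> 1" "z \<ge> 0"
    and z: "\<And>l. l \<in> {1..n} \<Longrightarrow> (\<Sum>t = 1..l. \<lceil>z * (real t)\<^sup>2\<rceil>) \<le> (int l)\<^sup>2"
  shows "\<exists>\<pi>. z \<le> worst_case \<pi> n 2"
proof -
  \<comment> \<open>For \<open>t >= 1\<close>, the least number of cells whose share of the square
    of side \<open>t\<close> is at least \<open>z\<close>; as \<open>z >= 0\<close>, nothing is lost
    by \<open>nat\<close>.\<close>
  define c where "c t = nat \<lceil>z * (real t)\<^sup>2\<rceil>" for t
  have int_c: "int (c t) = \<lceil>z * (real t)\<^sup>2\<rceil>" for t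
  proof -
    have "0 \<le> z * (real t)\<^sup>2" using \<open>z \<ge> 0\<close> by simp
    then have "0 \<le> \<lceil>z * (real t)\<^sup>2\<rceil>" by linarith
    then show ?thesis by (simp add: c_def)
  qed
  have "(\<Sum>t = 1..l. c t) \<le> l\<^sup>2" if "l \<in> {1..n}" for l
  proof -
    have "int (\<Sum>t = 1..l. c t) \<le> int (l\<^sup>2)" using z[OF that] by (simp add: int_c)
    then show ?thesis by (simp only: of_nat_le_iff)
  qed
  then obtain A where A_all: "\<forall>t\<in>{1..n}. A t \<subseteq> {1..t} \<times> {1..t} \<and> sym (A t) \<and> card (A t) = c t"
      and disj: "disjoint_family_on A {1..n}"
    using disjoint_symmetric_sets[of n c] by metis
  then have A: "\<And>t. t \<in> {1..n} \<Longrightarrow> A t \<subseteq> {1..t} \<times> {1..t}" "\<And>t. t \<in> {1..n} \<Longrightarrow> sym (A t)"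
    and card: "\<And>t. t \<in> {1..n} \<Longrightarrow> card (A t) = c t"
    by blast+
  have "z \<le> success_prob (pair_policy A) n 2 v" if v: "v \<in> instances n" for v
  proof -
    define i where "i = peak_time n v"
    have i: "i \<in> {1..n}" using peak_time_in[OF v] by (simp add: i_def)
    have "z * (real i)\<^sup>2 \<le> of_int (int (c i))" unfolding int_c by (rule le_of_int_ceiling)
    then have "z \<le> card (A i) / (real i)\<^sup>2"
      using i card[OF i] by (simp add: pos_le_divide_eq)
    then show ?thesis using success_prob_pair_policy[OF v A disj] by (simp add: i_def)
  qed
  then have "z \<le> worst_case (pair_policy A) n 2"
    unfolding worst_case_def using instances_nonempty[OF \<open>n \<ge> 1\<close>] by (intro cINF_greatest) auto
  then show ?thesis by (rule exI[of _ "pair_policy A"])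
qed

theorem theorem14:
  fixes n :: nat
  assumes "n \<ge> 1"
  shows "is_maximum
    {z :: real. z \<in> {0..1} \<and>
       (\<forall>l\<in>{1..n}. (\<Sum>t = 1..l. \<lceil>z * (real t)\<^sup>2\<rceil>) \<le> (int l)\<^sup>2)}
    (OPT_det_full n 2)"
proof -
  \<comment> \<open>With an optimal policy fixed, the counting bound for single policies applies to
    the optimum itself.\<close>
  obtain \<pi> where \<pi>: "OPT_det_full n 2 = worst_case \<pi> n 2"
    using OPT_det_full_attained(1)[OF assms] by blast
  have "0 \<le> worst_case \<pi> n 2"
    unfolding worst_case_def using instances_nonempty[OF assms]
    by (intro cINF_greatest) (auto simp: success_prob_def)
  moreover have "worst_case \<pi> n 2 \<le> 1"
  proof -
    have "worst_case \<pi> n 2 \<le> success_prob \<pi> n 2 (ramp n 1)"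
      using assms by (intro worst_case_le ramp_in_instances) auto
    also have "\<dots> \<le> 1" by (simp add: success_prob_def)
    finally show ?thesis .
  qed
  moreover have "z \<le> OPT_det_full n 2"
    if "z \<ge> 0" and z: "\<forall>l\<in>{1..n}. (\<Sum>t = 1..l. \<lceil>z * (real t)\<^sup>2\<rceil>) \<le> (int l)\<^sup>2" for z
  proof -
    obtain \<rho> where "z \<le> worst_case \<rho> n 2"
      using exists_policy_worst_case_ge[OF assms \<open>z \<ge> 0\<close>] z by blast
    also have "\<dots> \<le> OPT_det_full n 2" by (rule OPT_det_full_attained(2)[OF assms])
    finally show ?thesis .
  qed
  ultimately show ?thesis
    using sum_ceiling_worst_case_le[of _ n \<pi> 2] by (auto simp: is_maximum_def \<pi>)
qed

end
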